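(* Let $\rho>0$ and $m\ge1$. Let $\mathcal{T}_D$ be a non-negative hierarchical tree of depth $T$ whose shape is fixed and whose attributes $q_D(u)$ are determined by a dataset $D$, where the root attribute $n=q_D(u_0)$ satisfies $|q_D(u_0)-q_{D'}(u_0)|\le m$ for all unbounded neighbors $D\sim D'$ (each user contributes $m$ records), and let $\mathrm{GS}_2(q)$ be such that for every level $\ell\in\{1,\dots,T\}$ and all unbounded neighbors $D\sim D'$, $\|(q_D(u))_{u\in V_\ell}-(q_{D'}(u))_{u\in V_\ell}\|_2\le\mathrm{GS}_2(q)$. Then the unbounded variant of \texttt{InfTDA} satisfies $\left(\frac{m^2}{T}+\mathrm{GS}_2(q)^2\right)\frac{\rho}{2}$-zCDP under unbounded privacy.
   Context: Unbounded neighbors: $D\sim D'$ if one is obtained from the other by adding or removing a single user (with all their records). $\rho$-zCDP: for all neighbors $D\sim D'$ and all $\alpha>1$, $D_\alpha(\mathcal{M}(D)\|\mathcal{M}(D'))\le\alpha\rho$, with $D_\alpha$ the Rényi divergence. A non-negative hierarchical tree of depth $T$: rooted tree with levels $V_0=\{u_0\},\dots,V_T$, non-negative integer attributes, and $q(u)=\sum_{v\in\mathcal{C}(u)}q(v)$ for each non-leaf $u$ with children $\mathcal{C}(u)$; $\mathbf{q}_{\mathcal{C}}(u)$ denotes the vector of children attributes. $\mathcal{N}_{\mathbb{Z}}(0,\sigma^2)$ is the discrete Gaussian, $\Pr[Z=z]\propto e^{-z^2/(2\sigma^2)}$. $\texttt{IntOpt}_\infty(\mathbf{x},c)$ ($\mathbf{x}\in\mathbb{Z}^d$,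 $c$ integer): $z_i\gets\max(\lceil(c-\sum_kx_k)/d\rceil,-x_i)$; $t\gets\|\mathbf{z}\|_\infty$; $I\gets$ indices sorted by ascending $x_i$; $j\gets0$; while $\sum_iz_i>c-\sum_ix_i$: $\Delta\gets\sum_iz_i-c+\sum_ix_i$, $z_{I[j]}\gets\max(z_{I[j]}-\Delta,-x_{I[j]},-t)$, $j\gets(j+1)\bmod|I|$, if $j=0$ then $t\gets t+1$; return $\mathbf{x}+\mathbf{z}$. Unbounded variant of \texttt{InfTDA}$(\mathcal{T},\rho)$: set $\tilde n=n+Z_0$ with $Z_0\sim\mathcal{N}_{\mathbb{Z}}(0,T/\rho)$ and $\tilde V_0=\{(u_0,\tilde n)\}$; for $\ell=1,\dots,T$: $\tilde V_\ell=\emptyset$, and for each $(u,c)\in\tilde V_{\ell-1}$: $\tilde{\mathbf{q}}=\mathbf{q}_{\mathcal{C}}(u)+\mathbf{Z}$ with fresh i.i.d. $\mathcal{N}_{\mathbb{Z}}(0,T/\rho)$ coordinates, $\bar{\mathbf{q}}=\texttt{IntOpt}_\infty(\tilde{\mathbf{q}},c)$, and add to $\tilde V_\ell$ the pairs $(C_j,\bar q_j)$ with $\bar q_j>0$ ($C_j$ the $j$-th child of $u$). Output: $\bigcup_\ell\tilde V_\ell$. *)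

theory Defs
  imports
    "HOL-Probability.Probability"
    "HOL-Library.Multiset"
    "HOL-Library.While_Combinator"
begin

(* A dataset is a finite multiset of records, each tagged with the user who owns it. *)
type_synonym ('u, 'r) dataset = "('u \<times> 'r) multiset"

definition remove_user :: "'u \<Rightarrow> ('u, 'r) dataset \<Rightarrow> ('u, 'r) dataset" where
  "remove_user a D = filter_mset (\<lambda>r. fst r \<noteq> a) D"

definition users :: "('u, 'r) dataset \<Rightarrow> 'u set" where
  "users D = fst ` set_mset D"

(* The set DD is the universe of admissible datasets, for instance those in which every user
   owns exactly m records. *)
definition unbounded_neighbors ::
    "('u, 'r) dataset set \<Rightarrow> ('u, 'r) dataset \<Rightarrow> ('u, 'r) dataset \<Rightarrow> bool" where
  "unbounded_neighbors DD D D' \<longleftrightarrow> D \<in> DD \<and> D' \<in> DD \<and>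
     ((\<exists>a\<in>users D. D' = remove_user a D) \<or> (\<exists>a\<in>users D'. D = remove_user a D'))"

(* The divergence is infinite if P is not absolutely continuous with respect to Q or if the
   series diverges. Points outside the support of Q contribute 0 because 0 powr a = 0. *)
definition renyi_divergence :: "real \<Rightarrow> 'a pmf \<Rightarrow> 'a pmf \<Rightarrow> ereal" where
  "renyi_divergence \<alpha> P Q =
     (if set_pmf P \<subseteq> set_pmf Q \<and>
         (\<lambda>x. pmf P x powr \<alpha> * pmf Q x powr (1 - \<alpha>)) summable_on UNIV
      then ereal (ln (\<Sum>\<^sub>\<infinity>x. pmf P x powr \<alpha> * pmf Q x powr (1 - \<alpha>)) / (\<alpha> - 1))
      else \<infinity>)"

definition zCDP :: "('d \<Rightarrow> 'd \<Rightarrow> bool) \<Rightarrow> real \<Rightarrow> ('d \<Rightarrow> 'a pmf) \<Rightarrow> bool" where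
  "zCDP nb \<rho> M \<longleftrightarrow>
     (\<forall>D D'. nb D D' \<longrightarrow> (\<forall>\<alpha>>1. renyi_divergence \<alpha> (M D) (M D') \<le> ereal (\<alpha> * \<rho>)))"

(* The parameter is the variance proxy sigma squared. *)
definition discrete_gaussian :: "real \<Rightarrow> int pmf" where
  "discrete_gaussian \<sigma>2 = embed_pmf (\<lambda>z. exp (- (real_of_int z)\<^sup>2 / (2 * \<sigma>2)) /
     (\<Sum>\<^sub>\<infinity>k::int. exp (- (real_of_int k)\<^sup>2 / (2 * \<sigma>2))))"

lemma summable_discrete_gaussian:
  assumes "\<sigma>2 > 0"
  shows "(\<lambda>k::int. exp (- (real_of_int k)\<^sup>2 / (2 * \<sigma>2))) summable_on UNIV"
proof -
  define f where "f = (\<lambda>k::int. exp (- (real_of_int k)\<^sup>2 / (2 * \<sigma>2)))"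
  define r where "r = exp (- 1 / (2 * \<sigma>2))"
  have le: "f (int n) \<le> r ^ n" for n
  proof -
    have "real n \<le> (real n)\<^sup>2"
      by (cases n) (auto simp: power2_eq_square)
    hence "- (real n)\<^sup>2 / (2 * \<sigma>2) \<le> real n * (- 1 / (2 * \<sigma>2))"
      using assms by (simp add: divide_simps)
    thus ?thesis
      unfolding f_def r_def by (simp flip: exp_of_nat_mult)
  qed
  have "summable (\<lambda>n. r ^ n)"
    using assms by (intro summable_geometric) (simp add: r_def)
  hence "summable (\<lambda>n. norm (f (int n)))"
    by (rule summable_comparison_test') (use le in \<open>auto simp: f_def\<close>)
  hence nat: "(\<lambda>n. f (int n)) summable_on UNIV"
    by (rule norm_summable_imp_summable_on)
  have "f summable_on range int"
    using nat by (subst summable_on_reindex) (auto simp: o_def)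
  moreover have "f summable_on range (\<lambda>n. - int n)"
    using nat by (subst summable_on_reindex) (auto simp: o_def f_def inj_def)
  ultimately have "f summable_on (range int \<union> range (\<lambda>n. - int n))"
    by (rule summable_on_union)
  moreover have "range int \<union> range (\<lambda>n. - int n) = UNIV"
  proof -
    have "k \<in> range int \<union> range (\<lambda>n. - int n)" for k :: int
      by (cases k rule: int_cases2) auto
    thus ?thesis by blast
  qed
  ultimately show ?thesis by (simp add: f_def)
qed

(* embed_pmf is unspecified on functions that are not probability mass functions, so this
   is what makes the definition above meaningful. *)
lemma pmf_discrete_gaussian:
  assumes "\<sigma>2 > 0"
  shows "pmf (discrete_gaussian \<sigma>2) z = exp (- (real_of_int z)\<^sup>2 / (2 * \<sigma>2)) /
           (\<Sum>\<^sub>\<infinity>k::int. exp (- (real_of_int k)\<^sup>2 / (2 * \<sigma>2)))"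
proof -
  define f where "f = (\<lambda>k::int. exp (- (real_of_int k)\<^sup>2 / (2 * \<sigma>2)))"
  define S where "S = infsum f UNIV"
  have f: "f summable_on UNIV"
    unfolding f_def by (rule summable_discrete_gaussian[OF assms])
  have "f 0 \<le> S"
    unfolding S_def using f finite_sum_le_infsum[of f UNIV "{0}"] by (simp add: f_def)
  hence S: "S > 0" by (simp add: f_def)
  have nonneg: "f k / S \<ge> 0" for k
    using S by (simp add: f_def)
  have "(f has_sum S) UNIV"
    unfolding S_def by (rule has_sum_infsum[OF f])
  hence "((\<lambda>k. f k * inverse S) has_sum S * inverse S) UNIV"
    by (rule has_sum_cmult_left)
  hence sum: "((\<lambda>k. f k / S) has_sum 1) UNIV"
    using S by (simp add: field_simps)
  hence "(\<lambda>k. norm (f k / S)) summable_on UNIV"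
    using nonneg by (simp only: real_norm_def abs_of_nonneg has_sum_iff)
  hence abs: "Infinite_Set_Sum.abs_summable_on (\<lambda>k. f k / S) UNIV"
    by (rule abs_summable_equivalent[THEN iffD1])
  have "(\<integral>\<^sup>+k. ennreal (f k / S) \<partial>count_space UNIV) = ennreal (infsum (\<lambda>k. f k / S) UNIV)"
    using nn_integral_conv_infsetsum[OF abs nonneg] infsetsum_infsum[OF abs] by simp
  hence "(\<integral>\<^sup>+k. ennreal (f k / S) \<partial>count_space UNIV) = 1"
    using sum by (simp add: has_sum_iff)
  hence "pmf (embed_pmf (\<lambda>k. f k / S)) z = f z / S"
    using S by (intro pmf_embed_pmf) (auto simp: f_def)
  thus ?thesis
    by (simp add: discrete_gaussian_def f_def S_def)
qed

(* The shape of a tree is given by its root and the ordered list of children of each node. *)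
primrec tree_level :: "'v \<Rightarrow> ('v \<Rightarrow> 'v list) \<Rightarrow> nat \<Rightarrow> 'v set" where
  "tree_level u0 ch 0 = {u0}"
| "tree_level u0 ch (Suc l) = (\<Union>u\<in>tree_level u0 ch l. set (ch u))"

definition tree_nodes :: "'v \<Rightarrow> ('v \<Rightarrow> 'v list) \<Rightarrow> 'v set" where
  "tree_nodes u0 ch = (\<Union>l. tree_level u0 ch l)"

(* Leaves may occur at any level; some node lies at level T and none below it. *)
definition rooted_tree :: "'v \<Rightarrow> ('v \<Rightarrow> 'v list) \<Rightarrow> nat \<Rightarrow> bool" where
  "rooted_tree u0 ch T \<longleftrightarrow>
     (\<forall>u\<in>tree_nodes u0 ch. distinct (ch u) \<and> u0 \<notin> set (ch u)) \<and>
     (\<forall>u\<in>tree_nodes u0 ch. \<forall>v\<in>tree_nodes u0 ch. u \<noteq> v \<longrightarrow> set (ch u) \<inter> set (ch v) = {}) \<and>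
     tree_level u0 ch T \<noteq> {} \<and> tree_level u0 ch (Suc T) = {}"

definition nonneg_hierarchical_tree :: "'v \<Rightarrow> ('v \<Rightarrow> 'v list) \<Rightarrow> nat \<Rightarrow> ('v \<Rightarrow> int) \<Rightarrow> bool" where
  "nonneg_hierarchical_tree u0 ch T q \<longleftrightarrow> rooted_tree u0 ch T \<and>
     (\<forall>u\<in>tree_nodes u0 ch. q u \<ge> 0 \<and> (ch u \<noteq> [] \<longrightarrow> q u = (\<Sum>v\<in>set (ch u). q v)))"

(* Loop state: (z, t, j). *)
definition int_opt_step ::
    "int list \<Rightarrow> int \<Rightarrow> nat list \<Rightarrow> int list \<times> int \<times> nat \<Rightarrow> int list \<times> int \<times> nat" where
  "int_opt_step x c I = (\<lambda>(z, t, j).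
     let \<Delta> = sum_list z - c + sum_list x;
         i = I ! j;
         z' = z[i := Max {z ! i - \<Delta>, - (x ! i), - t}];
         j' = (j + 1) mod length I;
         t' = (if j' = 0 then t + 1 else t)
     in (z', t', j'))"

(* The result is None iff the loop does not terminate, which is the case for c < 0. Ties in the
   ordering of the indices are broken by position. *)
definition int_opt :: "int list \<Rightarrow> int \<Rightarrow> int list option" where
  "int_opt x c =
     (let d = length x;
          z0 = map (\<lambda>xi. max \<lceil>real_of_int (c - sum_list x) / real d\<rceil> (- xi)) x;
          t0 = Max (insert 0 (abs ` set z0));
          I = sort_key (\<lambda>i. x ! i) [0..<d]
      in map_option (\<lambda>(z, t, j). map2 (+) x z)
           (while_option (\<lambda>(z, t, j). sum_list z > c - sum_list x) (int_opt_step x c I) (z0, t0, 0)))"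

(* The mechanism is an spmf whose outcome None means non-termination. *)
definition expand_node ::
    "('v \<Rightarrow> 'v list) \<Rightarrow> ('v \<Rightarrow> int) \<Rightarrow> real \<Rightarrow> 'v \<times> int \<Rightarrow> ('v \<times> int) list spmf" where
  "expand_node ch q \<sigma>2 = (\<lambda>(u, c).
     map_pmf (\<lambda>Z. map_option (\<lambda>qbar. filter (\<lambda>(v, a). a > 0) (zip (ch u) qbar))
                    (int_opt (map2 (+) (map q (ch u)) Z) c))
       (replicate_pmf (length (ch u)) (discrete_gaussian \<sigma>2)))"

primrec expand_level ::
    "('v \<Rightarrow> 'v list) \<Rightarrow> ('v \<Rightarrow> int) \<Rightarrow> real \<Rightarrow> ('v \<times> int) list \<Rightarrow> ('v \<times> int) list spmf" where
  "expand_level ch q \<sigma>2 [] = return_spmf []"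
| "expand_level ch q \<sigma>2 (p # ps) =
     bind_spmf (expand_node ch q \<sigma>2 p) (\<lambda>xs.
     bind_spmf (expand_level ch q \<sigma>2 ps) (\<lambda>ys.
     return_spmf (xs @ ys)))"

(* expand_levels k W is the union of the level sets when k further levels are processed
   starting from the level W. *)
primrec expand_levels ::
    "('v \<Rightarrow> 'v list) \<Rightarrow> ('v \<Rightarrow> int) \<Rightarrow> real \<Rightarrow> nat \<Rightarrow> ('v \<times> int) list \<Rightarrow> ('v \<times> int) set spmf" where
  "expand_levels ch q \<sigma>2 0 W = return_spmf (set W)"
| "expand_levels ch q \<sigma>2 (Suc k) W =
     bind_spmf (expand_level ch q \<sigma>2 W) (\<lambda>W'.
     bind_spmf (expand_levels ch q \<sigma>2 k W') (\<lambda>S.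
     return_spmf (set W \<union> S)))"

definition inf_tda_unbounded ::
    "'v \<Rightarrow> ('v \<Rightarrow> 'v list) \<Rightarrow> nat \<Rightarrow> ('v \<Rightarrow> int) \<Rightarrow> real \<Rightarrow> ('v \<times> int) set spmf" where
  "inf_tda_unbounded u0 ch T q \<rho> =
     bind_pmf (discrete_gaussian (real T / \<rho>)) (\<lambda>z0.
       expand_levels ch q (real T / \<rho>) T [(u0, q u0 + z0)])"

end

theory Submission
  imports Defs "HOL-Library.Sublist"
begin

text \<open>
  For fixed \<open>\<alpha> > 1\<close>, the exponentiated Renyi divergence \<open>\<Sum>P\<^sup>\<alpha> Q\<^sup>1\<^sup>-\<^sup>\<alpha>\<close> is multiplicative along adaptive
  composition and does not grow under post-processing. Both facts follow from the joint convexity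
  of \<open>a\<^sup>\<alpha> b\<^sup>1\<^sup>-\<^sup>\<alpha>\<close>. As the true attributes enter the mechanism only through the noisy vectors,
  its privacy loss is that of the discrete Gaussians. The nodes surviving in one level are distinct
  and have disjoint sets of children, so a level costs at most \<open>\<alpha> GS\<^sub>2\<^sup>2 / (2 \<sigma>\<^sup>2)\<close>,
  whatever the outcome of the previous levels, and the root costs \<open>\<alpha> m\<^sup>2 / (2 \<sigma>\<^sup>2)\<close>.

  Completing the square reduces the divergence of two shifted discrete Gaussians to
  \<open>\<theta>(x) \<le> \<theta>(0)\<close> for \<open>\<theta>(x) = \<Sum>z. exp (- c (z - x)\<^sup>2)\<close>. Instead of Poisson summation, substitute
  \<open>(m, n) \<mapsto> (m + n, m - n)\<close> in the double series \<open>\<theta>(a) \<theta>(b)\<close> and split it by the parity of \<open>m + n\<close>.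
  By AM-GM this gives \<open>2 \<theta>(x)\<^sup>2 \<le> \<theta>(0) (\<theta>(2 x) + \<theta>(0))\<close>, so \<open>M = sup \<theta>\<close>, finite by periodicity,
  satisfies \<open>(2 M + \<theta>(0)) (M - \<theta>(0)) \<le> 0\<close>.
\<close>

section \<open>Moments of the Renyi divergence\<close>

lemma Bernoulli_powr:
  fixes x \<alpha> :: real
  assumes "x \<ge> 0" "\<alpha> > 1"
  shows "1 + \<alpha> * (x - 1) \<le> x powr \<alpha>"
proof -
  \<comment> \<open>Young's inequality for the conjugate exponents \<alpha> and
    \<open>\<alpha> / (\<alpha> - 1)\<close>, with second factor 1.\<close>
  have "x * 1 \<le> x powr \<alpha> / \<alpha> + 1 powr (\<alpha> / (\<alpha> - 1)) / (\<alpha> / (\<alpha> - 1))"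
    using assms by (intro Youngs_inequality) (auto simp: field_simps)
  hence "\<alpha> * x \<le> \<alpha> * (x powr \<alpha> / \<alpha> + (\<alpha> - 1) / \<alpha>)"
    using assms by (intro mult_left_mono) auto
  also have "\<alpha> * (x powr \<alpha> / \<alpha> + (\<alpha> - 1) / \<alpha>) = x powr \<alpha> + (\<alpha> - 1)"
    using assms by (simp add: field_simps)
  finally show ?thesis by (simp add: ring_distribs)
qed

text \<open>The function \<open>a powr \<alpha> * b powr (1 - \<alpha>)\<close> is convex and
  homogeneous of degree 1, so it lies above its tangent plane along the ray
  \<open>a = t * b\<close>. This is Bernoulli at \<open>a / (b * t)\<close>, scaled by
  \<open>b * t powr \<alpha>\<close>. The last hypothesis excludes \<open>b = 0 < a\<close>, where
  the limit is infinite but \<open>0 powr (1 - \<alpha>)\<close> is 0.\<close>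

lemma powr_tangent:
  fixes a b t \<alpha> :: real
  assumes "a \<ge> 0" "b \<ge> 0" "t > 0" "\<alpha> > 1" "b = 0 \<Longrightarrow> a = 0"
  shows "\<alpha> * t powr (\<alpha> - 1) * a \<le> a powr \<alpha> * b powr (1 - \<alpha>) + (\<alpha> - 1) * t powr \<alpha> * b"
proof (cases "b = 0")
  case True
  thus ?thesis using assms by simp
next
  case False
  hence b: "b > 0" using assms by simp
  have "b * t powr \<alpha> * (1 + \<alpha> * (a / (b * t) - 1)) \<le> b * t powr \<alpha> * (a / (b * t)) powr \<alpha>"
    using Bernoulli_powr[of "a / (b * t)" \<alpha>] assms b by (intro mult_left_mono) auto
  also have "\<dots> = a powr \<alpha> * b powr (1 - \<alpha>)"
    using assms b by (simp add: powr_divide powr_mult powr_diff)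
  also have "b * t powr \<alpha> * (1 + \<alpha> * (a / (b * t) - 1)) =
      \<alpha> * t powr (\<alpha> - 1) * a - (\<alpha> - 1) * t powr \<alpha> * b"
    using assms b by (simp add: powr_diff field_simps)
  finally show ?thesis by simp
qed

text \<open>Sum the tangent line bound of \<open>powr_tangent\<close> at the ratio \<open>t = A / B\<close>.\<close>

lemma powr_jointly_convex:
  fixes a b :: "'a \<Rightarrow> real"
  assumes "\<alpha> > 1"
    and nonneg: "\<And>x. a x \<ge> 0" "\<And>x. b x \<ge> 0" "A \<ge> 0" "B \<ge> 0"
    and ac: "\<And>x. b x = 0 \<Longrightarrow> a x = 0"
    and A: "(\<integral>\<^sup>+x. ennreal (a x) \<partial>count_space UNIV) = ennreal A"
    and B: "(\<integral>\<^sup>+x. ennreal (b x) \<partial>count_space UNIV) = ennreal B"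
  shows "ennreal (A powr \<alpha> * B powr (1 - \<alpha>)) \<le>
    (\<integral>\<^sup>+x. ennreal (a x powr \<alpha> * b x powr (1 - \<alpha>)) \<partial>count_space UNIV)"
    (is "_ \<le> ?I")
proof (cases "A = 0 \<or> B = 0")
  case True
  thus ?thesis using \<open>\<alpha> > 1\<close> by auto
next
  case False
  hence pos: "A > 0" "B > 0" using nonneg by auto
  define t where "t = A / B"
  have t: "t > 0" using pos by (simp add: t_def)
  have "ennreal (\<alpha> * t powr (\<alpha> - 1) * A) =
        (\<integral>\<^sup>+x. ennreal (\<alpha> * t powr (\<alpha> - 1)) * ennreal (a x) \<partial>count_space UNIV)"
    using \<open>\<alpha> > 1\<close> nonneg by (subst nn_integral_cmult) (auto simp: A ennreal_mult)
  also have "\<dots> \<le> (\<integral>\<^sup>+x. ennreal (a x powr \<alpha> * b x powr (1 - \<alpha>)) +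
       ennreal ((\<alpha> - 1) * t powr \<alpha>) * ennreal (b x) \<partial>count_space UNIV)"
    using \<open>\<alpha> > 1\<close> nonneg powr_tangent[OF nonneg(1,2) t \<open>\<alpha> > 1\<close> ac]
    by (intro nn_integral_mono) (simp flip: ennreal_mult ennreal_plus)
  also have "\<dots> = ?I + ennreal ((\<alpha> - 1) * t powr \<alpha> * B)"
    using \<open>\<alpha> > 1\<close> nonneg
    by (subst nn_integral_add) (auto simp: nn_integral_cmult B ennreal_mult)
  finally have le: "ennreal (\<alpha> * t powr (\<alpha> - 1) * A) \<le> ?I + ennreal ((\<alpha> - 1) * t powr \<alpha> * B)" .
  \<comment> \<open>The tangent plane touches at \<open>t = A / B\<close>, so the terms linear in
    \<open>B\<close> cancel exactly.\<close>
  have *: "\<alpha> * t powr (\<alpha> - 1) * A =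
      A powr \<alpha> * B powr (1 - \<alpha>) + (\<alpha> - 1) * t powr \<alpha> * B"
    using pos by (simp add: t_def powr_divide powr_diff field_simps)
  show ?thesis
  proof (cases ?I)
    case (real r)
    thus ?thesis using le \<open>\<alpha> > 1\<close> nonneg unfolding *
      by (simp flip: ennreal_plus add: ennreal_le_iff)
  qed simp
qed

section \<open>Composition and post-processing\<close>

definition renyi_moment :: "real \<Rightarrow> 'a pmf \<Rightarrow> 'a pmf \<Rightarrow> ennreal" where
  "renyi_moment \<alpha> P Q =
     (\<integral>\<^sup>+x. ennreal (pmf P x powr \<alpha> * pmf Q x powr (1 - \<alpha>)) \<partial>count_space UNIV)"

text \<open>Where the divergence \<open>D\<close> is finite, the moment is
  \<open>exp ((\<alpha> - 1) * D)\<close>. The support inclusion is stated separately because points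
  outside the support of \<open>Q\<close> contribute 0 to the moment.\<close>

definition renyi_bounded :: "real \<Rightarrow> 'a pmf \<Rightarrow> 'a pmf \<Rightarrow> real \<Rightarrow> bool" where
  "renyi_bounded \<alpha> P Q \<epsilon> \<longleftrightarrow>
     set_pmf P \<subseteq> set_pmf Q \<and> renyi_moment \<alpha> P Q \<le> ennreal (exp ((\<alpha> - 1) * \<epsilon>))"

lemma renyi_divergence_le:
  assumes "\<alpha> > 1" "\<epsilon> \<ge> 0" "renyi_bounded \<alpha> P Q \<epsilon>"
  shows "renyi_divergence \<alpha> P Q \<le> ereal \<epsilon>"
proof -
  define f where "f = (\<lambda>x. pmf P x powr \<alpha> * pmf Q x powr (1 - \<alpha>))"
  have nonneg: "f x \<ge> 0" for x by (simp add: f_def)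
  have bound: "(\<integral>\<^sup>+x. ennreal (f x) \<partial>count_space UNIV) \<le> ennreal (exp ((\<alpha> - 1) * \<epsilon>))"
    using assms by (simp add: renyi_bounded_def renyi_moment_def f_def)
  hence "integrable (count_space UNIV) f"
    using nonneg by (intro integrableI_nonneg) (auto simp: less_top[symmetric] top_unique)
  hence abs: "Infinite_Set_Sum.abs_summable_on f UNIV"
    by (simp add: Infinite_Set_Sum.abs_summable_on_def)
  hence sum: "f summable_on UNIV"
    using abs_summable_equivalent abs_summable_summable by blast
  have "ennreal (infsum f UNIV) \<le> ennreal (exp ((\<alpha> - 1) * \<epsilon>))"
    using bound nn_integral_conv_infsetsum[OF abs nonneg] infsetsum_infsum[OF abs] by simp
  hence le: "infsum f UNIV \<le> exp ((\<alpha> - 1) * \<epsilon>)" by simp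
  have "ln (infsum f UNIV) \<le> (\<alpha> - 1) * \<epsilon>"
  \<comment> \<open>For a vanishing sum the left side is the default \<open>ln 0 = 0\<close>, and
    \<epsilon> \<ge> 0 suffices.\<close>
  proof (cases "infsum f UNIV = 0")
    case False
    hence "infsum f UNIV > 0" using infsum_nonneg[of UNIV f] nonneg by fastforce
    thus ?thesis using le by (metis exp_le_cancel_iff exp_ln)
  qed (use assms in simp)
  hence "ln (infsum f UNIV) / (\<alpha> - 1) \<le> \<epsilon>"
    using assms by (simp add: field_simps)
  thus ?thesis
    using sum assms by (simp add: renyi_divergence_def renyi_bounded_def f_def)
qed

lemma renyi_bounded_mono:
  assumes "\<alpha> > 1" "renyi_bounded \<alpha> P Q \<epsilon>" "\<epsilon> \<le> \<epsilon>'"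
  shows "renyi_bounded \<alpha> P Q \<epsilon>'"
proof -
  have "ennreal (exp ((\<alpha> - 1) * \<epsilon>)) \<le> ennreal (exp ((\<alpha> - 1) * \<epsilon>'))"
    using assms by (intro ennreal_leI) simp
  thus ?thesis using assms unfolding renyi_bounded_def by (blast intro: order_trans)
qed

lemma renyi_bounded_refl:
  assumes "\<alpha> > 1" "\<epsilon> \<ge> 0"
  shows "renyi_bounded \<alpha> P P \<epsilon>"
proof -
  have "renyi_moment \<alpha> P P = (\<integral>\<^sup>+x. ennreal (pmf P x) \<partial>count_space UNIV)"
    unfolding renyi_moment_def
    by (intro nn_integral_cong arg_cong[of _ _ ennreal]) (simp flip: powr_add)
  also have "\<dots> = 1"
    using nn_integral_measure_pmf[of P "\<lambda>_. 1"] by simp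
  finally have "renyi_bounded \<alpha> P P 0" by (simp add: renyi_bounded_def)
  thus ?thesis using assms renyi_bounded_mono by blast
qed

text \<open>Adaptive composition with the intermediate outcome hidden. For each \<open>y\<close>,
  joint convexity moves the powers inside the sum over \<open>x\<close>; Tonelli then separates the
  two stages.\<close>

lemma renyi_bounded_bind:
  assumes "\<alpha> > 1" and PQ: "renyi_bounded \<alpha> P Q a"
    and KL: "\<And>x. x \<in> set_pmf P \<Longrightarrow> renyi_bounded \<alpha> (K x) (L x) b"
  shows "renyi_bounded \<alpha> (bind_pmf P K) (bind_pmf Q L) (a + b)"
proof -
  have ac: "pmf P x * pmf (K x) y = 0" if "pmf Q x * pmf (L x) y = 0" for x y
    using that PQ KL[of x] by (auto simp: renyi_bounded_def pmf_eq_0_set_pmf)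
  have bind: "(\<integral>\<^sup>+x. ennreal (pmf R x * pmf (N x) y) \<partial>count_space UNIV) =
      ennreal (pmf (bind_pmf R N) y)" for R :: "'a pmf" and N :: "'a \<Rightarrow> 'b pmf" and y
    by (simp add: ennreal_pmf_bind nn_integral_measure_pmf ennreal_mult)
  let ?g = "\<lambda>x y. ennreal (pmf P x powr \<alpha> * pmf Q x powr (1 - \<alpha>)) *
              ennreal (pmf (K x) y powr \<alpha> * pmf (L x) y powr (1 - \<alpha>))"
  have "renyi_moment \<alpha> (bind_pmf P K) (bind_pmf Q L) \<le>
    (\<integral>\<^sup>+y. \<integral>\<^sup>+x. ennreal ((pmf P x * pmf (K x) y) powr \<alpha> * (pmf Q x * pmf (L x) y) powr (1 - \<alpha>))
        \<partial>count_space UNIV \<partial>count_space UNIV)"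
    unfolding renyi_moment_def
    using assms(1) ac by (intro nn_integral_mono powr_jointly_convex) (auto simp: bind)
  also have "\<dots> = (\<integral>\<^sup>+y. \<integral>\<^sup>+x. ?g x y \<partial>count_space UNIV \<partial>count_space UNIV)"
    by (intro nn_integral_cong) (simp add: powr_mult mult_ac flip: ennreal_mult)
  also have "\<dots> = (\<integral>\<^sup>+x. \<integral>\<^sup>+y. ?g x y \<partial>count_space UNIV \<partial>count_space UNIV)"
    using nn_integral_fst_count_space[of "\<lambda>(x, y). ?g x y"]
      nn_integral_snd_count_space[of "\<lambda>(x, y). ?g x y"] by simp
  also have "\<dots> = (\<integral>\<^sup>+x. ennreal (pmf P x powr \<alpha> * pmf Q x powr (1 - \<alpha>)) *
      renyi_moment \<alpha> (K x) (L x) \<partial>count_space UNIV)"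
    by (simp add: nn_integral_cmult renyi_moment_def)
  also have "\<dots> \<le> (\<integral>\<^sup>+x. ennreal (pmf P x powr \<alpha> * pmf Q x powr (1 - \<alpha>)) *
      ennreal (exp ((\<alpha> - 1) * b)) \<partial>count_space UNIV)"
  proof (intro nn_integral_mono)
    fix x
    \<comment> \<open>Off the support of \<open>P\<close> both sides vanish, so the kernels are
      compared on the support only.\<close>
    show "ennreal (pmf P x powr \<alpha> * pmf Q x powr (1 - \<alpha>)) * renyi_moment \<alpha> (K x) (L x) \<le>
      ennreal (pmf P x powr \<alpha> * pmf Q x powr (1 - \<alpha>)) * ennreal (exp ((\<alpha> - 1) * b))"
      using KL[of x] assms(1)
      by (cases "x \<in> set_pmf P") (auto simp: renyi_bounded_def set_pmf_iff intro!: mult_left_mono)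
  qed
  also have "\<dots> = renyi_moment \<alpha> P Q * ennreal (exp ((\<alpha> - 1) * b))"
    by (simp add: nn_integral_multc renyi_moment_def)
  also have "\<dots> \<le> ennreal (exp ((\<alpha> - 1) * a)) * ennreal (exp ((\<alpha> - 1) * b))"
    using PQ by (intro mult_right_mono) (auto simp: renyi_bounded_def)
  also have "\<dots> = ennreal (exp ((\<alpha> - 1) * (a + b)))"
    by (simp add: exp_add ring_distribs flip: ennreal_mult)
  finally show ?thesis
    using PQ KL by (fastforce simp: renyi_bounded_def)
qed

text \<open>A deterministic map is a kernel common to both sides, which costs 0.\<close>

lemma renyi_bounded_map:
  assumes "\<alpha> > 1" "renyi_bounded \<alpha> P Q a"
  shows "renyi_bounded \<alpha> (map_pmf f P) (map_pmf f Q) a"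
  using renyi_bounded_bind[OF assms, of "\<lambda>x. return_pmf (f x)" "\<lambda>x. return_pmf (f x)" 0]
    renyi_bounded_refl[OF assms(1) order.refl, of "return_pmf (f _)"] by (simp add: map_pmf_def)

text \<open>Both sides propagate \<open>None\<close> in the same way, at cost 0; hence the
  hypothesis \<open>b \<ge> 0\<close>.\<close>

lemma renyi_bounded_bind_spmf:
  assumes "\<alpha> > 1" "b \<ge> 0" "renyi_bounded \<alpha> P Q a"
    and "\<And>x. Some x \<in> set_pmf P \<Longrightarrow> renyi_bounded \<alpha> (K x) (L x) b"
  shows "renyi_bounded \<alpha> (bind_spmf P K) (bind_spmf Q L) (a + b)"
  unfolding bind_spmf_def
proof (rule renyi_bounded_bind[OF assms(1,3)])
  fix x assume "x \<in> set_pmf P"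
  thus "renyi_bounded \<alpha> (case x of None \<Rightarrow> return_pmf None | Some x \<Rightarrow> K x)
          (case x of None \<Rightarrow> return_pmf None | Some x \<Rightarrow> L x) b"
    using assms renyi_bounded_refl by (cases x) auto
qed

lemma renyi_bounded_map_spmf:
  assumes "\<alpha> > 1" "renyi_bounded \<alpha> P Q a"
  shows "renyi_bounded \<alpha> (bind_spmf P (\<lambda>x. return_spmf (f x)))
           (bind_spmf Q (\<lambda>x. return_spmf (f x))) a"
  using renyi_bounded_bind_spmf[OF assms(1) order.refl assms(2)] renyi_bounded_refl[OF assms(1) order.refl]
  by (metis add.right_neutral)

section \<open>A theta function is maximal at the origin\<close>

text \<open>A Gaussian summed over a shifted lattice, hence a Jacobi theta function up to a factor.
  Values in \<open>ennreal\<close> postpone the question of convergence.\<close>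

definition theta :: "real \<Rightarrow> real \<Rightarrow> ennreal" where
  "theta c x = (\<integral>\<^sup>+(z::int). ennreal (exp (- c * (real_of_int z - x)\<^sup>2)) \<partial>count_space UNIV)"

definition theta_parity :: "real \<Rightarrow> bool \<Rightarrow> real \<Rightarrow> ennreal" where
  "theta_parity c p x =
     (\<integral>\<^sup>+(k::int). ennreal (exp (- c * (real_of_int (2 * k + of_bool p) - x)\<^sup>2)) \<partial>count_space UNIV)"

lemma nn_integral_count_space_times:
  fixes f :: "'a \<Rightarrow> ennreal" and g :: "'b \<Rightarrow> ennreal"
  shows "(\<integral>\<^sup>+x. f (fst x) * g (snd x) \<partial>count_space UNIV) =
    (\<integral>\<^sup>+x. f x \<partial>count_space UNIV) * (\<integral>\<^sup>+y. g y \<partial>count_space UNIV)"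
  by (subst nn_integral_fst_count_space[symmetric]) (simp add: nn_integral_cmult nn_integral_multc)

text \<open>With \<open>s = m + n\<close> and \<open>d = m - n\<close>,
  \<open>(m - a)^2 + (n - b)^2\<close> is half of \<open>(s - (a + b))^2 + (d - (a - b))^2\<close>,
  so \<open>c\<close> becomes \<open>c / 2\<close>. As \<open>s\<close> and \<open>d\<close> share
  their parity, the double series factors once that parity \<open>p\<close> is fixed.\<close>

lemma theta_mult:
  "theta c a * theta c b =
     (\<Sum>p\<in>UNIV. theta_parity (c / 2) p (a + b) * theta_parity (c / 2) p (a - b))"
proof -
  \<comment> \<open>The triple \<open>(p, k, l)\<close> encodes \<open>m + n = 2 * k + p\<close> and
    \<open>m - n = 2 * l + p\<close>, with \<open>p\<close> read as 0 or 1.\<close>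
  define \<phi> :: "bool \<times> int \<times> int \<Rightarrow> int \<times> int" where
    "\<phi> = (\<lambda>(p, k, l). (k + l + of_bool p, k - l))"
  have bij: "bij_betw \<phi> UNIV UNIV"
  proof (rule bij_betwI)
    let ?\<psi> = "\<lambda>(m, n). (odd (m + n), (m + n) div 2, (m - n) div 2)"
    show "?\<psi> (\<phi> x) = x" for x
      by (cases x; cases "fst x") (auto simp: \<phi>_def)
    show "\<phi> (?\<psi> y) = y" for y
    proof (cases y)
      case (Pair m n)
      have "(m + n) div 2 + (m - n) div 2 + (if odd (m + n) then 1 else 0) = m"
        "(m + n) div 2 - (m - n) div 2 = n"
        by presburger+
      thus ?thesis by (simp add: Pair \<phi>_def of_bool_def)
    qed
  qed auto
  define G where "G = (\<lambda>x z. ennreal (exp (- c * (real_of_int z - x)\<^sup>2)))"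
  define H where "H = (\<lambda>x p k. ennreal (exp (- (c / 2) * (real_of_int (2 * k + of_bool p) - x)\<^sup>2)))"
  have *: "G a (fst (\<phi> (p, k, l))) * G b (snd (\<phi> (p, k, l))) = H (a + b) p k * H (a - b) p l" for p k l
    unfolding G_def H_def \<phi>_def
    by (cases p) (simp_all add: power2_eq_square field_simps flip: ennreal_mult exp_add)
  have "theta c a * theta c b = (\<integral>\<^sup>+x. G a (fst x) * G b (snd x) \<partial>count_space UNIV)"
    unfolding nn_integral_count_space_times by (simp add: theta_def G_def)
  also have "\<dots> = (\<integral>\<^sup>+x. G a (fst (\<phi> x)) * G b (snd (\<phi> x)) \<partial>count_space UNIV)"
    by (rule nn_integral_bij_count_space[OF bij, symmetric])
  also have "\<dots> = (\<integral>\<^sup>+p. \<integral>\<^sup>+y. G a (fst (\<phi> (p, y))) * G b (snd (\<phi> (p, y)))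
      \<partial>count_space UNIV \<partial>count_space UNIV)"
    by (rule nn_integral_fst_count_space[symmetric])
  also have "\<dots> = (\<integral>\<^sup>+p. \<integral>\<^sup>+y. H (a + b) p (fst y) * H (a - b) p (snd y)
      \<partial>count_space UNIV \<partial>count_space UNIV)"
    by (intro nn_integral_cong) (metis * prod.collapse)
  also have "\<dots> = (\<Sum>p\<in>UNIV. theta_parity (c / 2) p (a + b) * theta_parity (c / 2) p (a - b))"
    unfolding nn_integral_count_space_times
    by (simp add: nn_integral_count_space_finite theta_parity_def H_def)
  finally show ?thesis .
qed

lemma ennreal_two_mult_le_squares: "2 * (x * y) \<le> x * x + y * (y::ennreal)"
proof (cases x; cases y)
  fix r s assume "x = ennreal r" "r \<ge> 0" "y = ennreal s" "s \<ge> 0"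
  moreover have "2 * (r * s) \<le> r * r + s * s"
    using sum_squares_bound[of r s] by (simp add: power2_eq_square)
  ultimately show ?thesis
    by (simp flip: ennreal_mult ennreal_plus ennreal_numeral)
qed (auto simp: ennreal_mult_top ennreal_top_mult)

lemma theta_square_le: "2 * (theta c x * theta c x) \<le> theta c 0 * (theta c (2 * x) + theta c 0)"
proof -
  let ?h = "theta_parity (c / 2)"
  have "2 * (theta c x * theta c x) = (\<Sum>p\<in>UNIV. 2 * (?h p (2 * x) * ?h p 0))"
    unfolding theta_mult[of c x x] by (simp add: sum_distrib_left)
  also have "\<dots> \<le> (\<Sum>p\<in>UNIV. ?h p (2 * x) * ?h p (2 * x) + ?h p 0 * ?h p 0)"
    by (intro sum_mono ennreal_two_mult_le_squares)
  \<comment> \<open>\<open>theta_mult\<close> read backwards at \<open>(2 * x, 0)\<close> and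
    \<open>(0, 0)\<close>: there the sum and the difference of the arguments agree, which produces
    the squares.\<close>
  also have "\<dots> = theta c (2 * x) * theta c 0 + theta c 0 * theta c 0"
    unfolding theta_mult by (simp add: sum.distrib)
  finally show ?thesis by (simp add: ring_distribs mult_ac)
qed

lemma theta_add_int: "theta c (x + of_int k) = theta c x"
proof -
  have "theta c (x + of_int k) =
      (\<integral>\<^sup>+(z::int). ennreal (exp (- c * (real_of_int (z + k) - (x + of_int k))\<^sup>2)) \<partial>count_space UNIV)"
    unfolding theta_def
    by (rule nn_integral_bij_count_space[symmetric])
       (rule bij_betwI[where g = "\<lambda>z. z - k"], auto)
  thus ?thesis by (simp add: theta_def)
qed

section \<open>Finiteness and maximum of theta\<close>

lemma theta_0_conv_infsum:
  assumes "c > 0"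
  shows "theta c 0 = ennreal (\<Sum>\<^sub>\<infinity>z::int. exp (- c * (real_of_int z)\<^sup>2))"
proof -
  let ?f = "\<lambda>z::int. exp (- c * (real_of_int z)\<^sup>2)"
  have "?f summable_on UNIV"
    using summable_discrete_gaussian[of "1 / (2 * c)"] assms by (simp add: field_simps)
  hence "(\<lambda>z. norm (?f z)) summable_on UNIV" by simp
  hence abs: "Infinite_Set_Sum.abs_summable_on ?f UNIV"
    by (rule abs_summable_equivalent[THEN iffD1])
  show ?thesis
    unfolding theta_def using nn_integral_conv_infsetsum[OF abs] infsetsum_infsum[OF abs] by simp
qed

text \<open>A crude bound uniform in \<open>x\<close>, from which the supremum of
  \<open>theta c\<close> is finite. Periodicity reduces it to the fractional part of
  \<open>x\<close>.\<close>

lemma theta_le_const: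
  assumes "c > 0"
  shows "theta c x \<le> ennreal (exp c) * theta (c / 2) 0"
proof -
  have f: "0 \<le> frac x" "frac x \<le> 1" by (auto intro: less_imp_le frac_lt_1)
  have "theta c x = theta c (frac x)"
    using theta_add_int[of c "frac x" "\<lfloor>x\<rfloor>"] by (simp add: frac_def)
  also have "\<dots> \<le> (\<integral>\<^sup>+(z::int). ennreal (exp c) * ennreal (exp (- (c / 2) * (real_of_int z - 0)\<^sup>2))
      \<partial>count_space UNIV)"
    unfolding theta_def
  proof (intro nn_integral_mono)
    fix z :: int
    define y where "y = frac x"
    have "y\<^sup>2 \<le> 1" using f by (simp add: y_def power_le_one)
    \<comment> \<open>Half of this square is \<open>(z - y)^2 - z^2 / 2 + y^2\<close>.\<close>
    moreover have "0 \<le> (real_of_int z - 2 * y)\<^sup>2" by simp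
    ultimately have "(real_of_int z)\<^sup>2 / 2 - 1 \<le> (real_of_int z - y)\<^sup>2"
      by (simp add: power2_eq_square algebra_simps)
    hence "c * ((real_of_int z)\<^sup>2 / 2 - 1) \<le> c * (real_of_int z - y)\<^sup>2"
      using assms by (intro mult_left_mono) auto
    thus "ennreal (exp (- c * (real_of_int z - frac x)\<^sup>2)) \<le>
        ennreal (exp c) * ennreal (exp (- (c / 2) * (real_of_int z - 0)\<^sup>2))"
      by (simp add: y_def algebra_simps flip: ennreal_mult exp_add)
  qed
  also have "\<dots> = ennreal (exp c) * theta (c / 2) 0"
    by (simp add: nn_integral_cmult theta_def)
  finally show ?thesis .
qed

lemma theta_le_theta_0:
  assumes "c > 0"
  shows "theta c x \<le> theta c 0"
proof -
  define C where "C = enn2real (ennreal (exp c) * theta (c / 2) 0)"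
  define \<theta> where "\<theta> = (\<lambda>x. enn2real (theta c x))"
  have fin: "ennreal (exp c) * theta (c / 2) 0 < top"
    using assms by (simp add: theta_0_conv_infsum ennreal_mult_less_top)
  have th: "theta c x = ennreal (\<theta> x)" for x
    using theta_le_const[OF assms, of x] fin unfolding \<theta>_def
    by (metis ennreal_enn2real le_less_trans)
  have nonneg: "\<theta> x \<ge> 0" for x by (simp add: \<theta>_def)
  have le_C: "\<theta> x \<le> C" for x
    unfolding \<theta>_def C_def using theta_le_const[OF assms, of x] fin by (intro enn2real_mono)
  hence bdd: "bdd_above (range \<theta>)" by (auto intro!: bdd_aboveI[of _ C])
  define M where "M = (SUP x. \<theta> x)"
  have le_M: "\<theta> x \<le> M" for x
    unfolding M_def using bdd by (rule cSUP_upper[OF UNIV_I])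
  have sq: "2 * (\<theta> x * \<theta> x) \<le> \<theta> 0 * (\<theta> (2 * x) + \<theta> 0)" for x
    using theta_square_le[of c x] nonneg
    by (simp add: th flip: ennreal_mult ennreal_plus ennreal_numeral)
  \<comment> \<open>Bounding \<open>\<theta> (2 * x)\<close> by \<open>M\<close> leaves a right side
    free of \<open>x\<close>; the square root lets it pass to the supremum.\<close>
  have "\<theta> x \<le> sqrt (\<theta> 0 * (M + \<theta> 0) / 2)" for x
  proof (rule real_le_rsqrt)
    have "\<theta> 0 * (\<theta> (2 * x) + \<theta> 0) \<le> \<theta> 0 * (M + \<theta> 0)"
      using nonneg le_M by (intro mult_left_mono add_right_mono)
    thus "(\<theta> x)\<^sup>2 \<le> \<theta> 0 * (M + \<theta> 0) / 2"
      using sq[of x] by (simp add: power2_eq_square)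
  qed
  hence "M \<le> sqrt (\<theta> 0 * (M + \<theta> 0) / 2)"
    unfolding M_def by (intro cSUP_least) auto
  hence "M\<^sup>2 \<le> (sqrt (\<theta> 0 * (M + \<theta> 0) / 2))\<^sup>2"
    using le_M[of 0] nonneg[of 0] by (intro power_mono) auto
  hence "M\<^sup>2 \<le> \<theta> 0 * (M + \<theta> 0) / 2"
    using le_M[of 0] nonneg[of 0] by simp
  hence prod: "(2 * M + \<theta> 0) * (M - \<theta> 0) \<le> 0"
    by (simp add: power2_eq_square algebra_simps)
  have "M \<le> \<theta> 0"
  proof (rule ccontr)
    assume "\<not> M \<le> \<theta> 0"
    hence "(2 * M + \<theta> 0) * (M - \<theta> 0) > 0"
      using nonneg[of 0] by (intro mult_pos_pos) auto
    thus False using prod by simp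
  qed
  thus ?thesis using le_M[of x] nonneg by (simp add: th)
qed

section \<open>Privacy loss of the mechanism\<close>

text \<open>The integrand is again a Gaussian, centred at \<open>b + \<alpha> * d\<close>. This
  centre need not be an integer, so the sum over the integers may differ from \<open>S\<close>;
  maximality of theta at 0 bounds it by \<open>S\<close>.\<close>

lemma renyi_bounded_discrete_gaussian:
  assumes "\<sigma>2 > 0" "\<alpha> > 1"
  shows "renyi_bounded \<alpha> (map_pmf ((+) a) (discrete_gaussian \<sigma>2))
           (map_pmf ((+) b) (discrete_gaussian \<sigma>2))
           (\<alpha> / (2 * \<sigma>2) * (real_of_int (a - b))\<^sup>2)"
proof -
  define c where "c = 1 / (2 * \<sigma>2)"
  have c: "c > 0" using assms by (simp add: c_def)
  define S where "S = (\<Sum>\<^sub>\<infinity>z::int. exp (- c * (real_of_int z)\<^sup>2))"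
  have th0: "theta c 0 = ennreal S"
    unfolding S_def by (rule theta_0_conv_infsum[OF c])
  have pmf: "pmf (map_pmf ((+) s) (discrete_gaussian \<sigma>2)) z = exp (- c * (real_of_int (z - s))\<^sup>2) / S"
    for s z
  proof -
    have "pmf (map_pmf ((+) s) (discrete_gaussian \<sigma>2)) (s + (z - s)) = pmf (discrete_gaussian \<sigma>2) (z - s)"
      by (rule pmf_map_inj') (simp add: inj_def)
    thus ?thesis
      using assms by (simp add: pmf_discrete_gaussian S_def c_def)
  qed
  have S: "S > 0"
  proof -
    \<comment> \<open>Division by 0 would make every mass 0, which no \<open>pmf\<close>
      allows.\<close>
    have "S \<noteq> 0"
    proof
      assume "S = 0"
      hence "pmf (map_pmf ((+) 0) (discrete_gaussian \<sigma>2)) z = 0" for z by (simp add: pmf)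
      thus False by (metis empty_iff equals0I pmf_eq_0_set_pmf set_pmf_not_empty)
    qed
    moreover have "S \<ge> 0" unfolding S_def by (intro infsum_nonneg) auto
    ultimately show ?thesis by simp
  qed
  have supp: "set_pmf (map_pmf ((+) s) (discrete_gaussian \<sigma>2)) = UNIV" for s
    using S by (auto simp: set_pmf_iff pmf simp del: set_map_pmf)
  define d where "d = real_of_int (a - b)"
  define E where "E = exp ((\<alpha> - 1) * (\<alpha> / (2 * \<sigma>2) * d\<^sup>2))"
  have integrand: "(exp (- c * (real_of_int (z - a))\<^sup>2) / S) powr \<alpha> *
        (exp (- c * (real_of_int (z - b))\<^sup>2) / S) powr (1 - \<alpha>) =
      (E / S) * exp (- c * (real_of_int z - (b + \<alpha> * d))\<^sup>2)" for z
  proof -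
    have "(exp (- c * (real_of_int (z - a))\<^sup>2) / S) powr \<alpha> *
        (exp (- c * (real_of_int (z - b))\<^sup>2) / S) powr (1 - \<alpha>) =
        exp (\<alpha> * (- c * (real_of_int (z - a))\<^sup>2) +
          (1 - \<alpha>) * (- c * (real_of_int (z - b))\<^sup>2)) / S"
    proof -
      have "S powr \<alpha> * S powr (1 - \<alpha>) = S" using S by (simp flip: powr_add)
      thus ?thesis by (simp add: powr_divide exp_powr_real mult_exp_exp mult.commute)
    qed
    \<comment> \<open>With \<open>w = z - b\<close>: \<open>\<alpha> * (w - d)^2 + (1 - \<alpha>) *
      w^2 = (w - \<alpha> * d)^2 - \<alpha> * (\<alpha> - 1) * d^2\<close>.\<close>
    also have "\<alpha> * (- c * (real_of_int (z - a))\<^sup>2) + (1 - \<alpha>) * (- c * (real_of_int (z - b))\<^sup>2) =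
        (\<alpha> - 1) * (\<alpha> * c * d\<^sup>2) + - c * (real_of_int z - (b + \<alpha> * d))\<^sup>2"
      by (simp add: d_def power2_eq_square algebra_simps)
    also have "exp \<dots> / S = (E / S) * exp (- c * (real_of_int z - (b + \<alpha> * d))\<^sup>2)"
      unfolding exp_add E_def c_def by simp
    finally show ?thesis .
  qed
  have E: "E \<ge> 0" by (simp add: E_def)
  have "renyi_moment \<alpha> (map_pmf ((+) a) (discrete_gaussian \<sigma>2)) (map_pmf ((+) b) (discrete_gaussian \<sigma>2))
      = ennreal (E / S) * theta c (b + \<alpha> * d)"
    using E S unfolding renyi_moment_def pmf integrand theta_def
    by (subst nn_integral_cmult[symmetric]) (auto simp flip: ennreal_mult)
  also have "\<dots> \<le> ennreal (E / S) * ennreal S"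
    using theta_le_theta_0[OF c] by (intro mult_left_mono) (auto simp: th0)
  also have "\<dots> = ennreal E"
    using E S by (simp flip: ennreal_mult)
  finally show ?thesis unfolding renyi_bounded_def supp E_def d_def by simp
qed

section \<open>From one coordinate to one level of the tree\<close>

lemma renyi_bounded_noisy_list:
  assumes "\<sigma>2 > 0" "\<alpha> > 1"
  shows "renyi_bounded \<alpha>
     (map_pmf (map2 (+) (map q vs)) (replicate_pmf (length vs) (discrete_gaussian \<sigma>2)))
     (map_pmf (map2 (+) (map q' vs)) (replicate_pmf (length vs) (discrete_gaussian \<sigma>2)))
     (\<alpha> / (2 * \<sigma>2) * (\<Sum>v\<leftarrow>vs. (real_of_int (q v - q' v))\<^sup>2))"
proof (induction vs)
  case Nil
  show ?case using renyi_bounded_refl[OF assms(2) order.refl] by simp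
next
  case (Cons v vs)
  let ?g = "discrete_gaussian \<sigma>2"
  have eq: "map_pmf (map2 (+) (map r (v # vs))) (replicate_pmf (length (v # vs)) ?g) =
      bind_pmf (map_pmf ((+) (r v)) ?g) (\<lambda>y. map_pmf ((#) y)
        (map_pmf (map2 (+) (map r vs)) (replicate_pmf (length vs) ?g)))" for r :: "'a \<Rightarrow> int"
    by (simp add: map_pmf_def bind_assoc_pmf bind_return_pmf)
  have "renyi_bounded \<alpha>
     (map_pmf (map2 (+) (map q (v # vs))) (replicate_pmf (length (v # vs)) ?g))
     (map_pmf (map2 (+) (map q' (v # vs))) (replicate_pmf (length (v # vs)) ?g))
     (\<alpha> / (2 * \<sigma>2) * (real_of_int (q v - q' v))\<^sup>2 +
      \<alpha> / (2 * \<sigma>2) * (\<Sum>v\<leftarrow>vs. (real_of_int (q v - q' v))\<^sup>2))"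
    unfolding eq
    by (intro renyi_bounded_bind renyi_bounded_discrete_gaussian renyi_bounded_map Cons.IH assms)
  thus ?case by (simp add: ring_distribs)
qed

text \<open>\<open>int_opt\<close>, its possible non-termination and the filter act only on the
  noisy vector and the given count, so they are post-processing.\<close>

lemma renyi_bounded_expand_node:
  assumes "\<sigma>2 > 0" "\<alpha> > 1"
  shows "renyi_bounded \<alpha> (expand_node ch q \<sigma>2 p) (expand_node ch q' \<sigma>2 p)
     (\<alpha> / (2 * \<sigma>2) * (\<Sum>v\<leftarrow>ch (fst p). (real_of_int (q v - q' v))\<^sup>2))"
proof -
  have "expand_node ch r \<sigma>2 p =
      map_pmf (\<lambda>x. map_option (\<lambda>qbar. filter (\<lambda>(v, a). a > 0) (zip (ch (fst p)) qbar)) (int_opt x (snd p)))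
        (map_pmf (map2 (+) (map r (ch (fst p)))) (replicate_pmf (length (ch (fst p))) (discrete_gaussian \<sigma>2)))"
    for r
    by (simp add: expand_node_def pmf.map_comp o_def split: prod.split)
  thus ?thesis
    by (simp only: renyi_bounded_map renyi_bounded_noisy_list assms)
qed

text \<open>One \<open>W\<close> serves both attribute functions, since composition conditions on a
  common outcome of the earlier levels. Each node draws fresh noise, so the costs add.\<close>

lemma renyi_bounded_expand_level:
  assumes "\<sigma>2 > 0" "\<alpha> > 1"
  shows "renyi_bounded \<alpha> (expand_level ch q \<sigma>2 W) (expand_level ch q' \<sigma>2 W)
     (\<alpha> / (2 * \<sigma>2) * (\<Sum>v\<leftarrow>concat (map (ch \<circ> fst) W). (real_of_int (q v - q' v))\<^sup>2))"
proof (induction W)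
  case Nil
  show ?case using renyi_bounded_refl[OF assms(2) order.refl] by simp
next
  case (Cons p W)
  have "renyi_bounded \<alpha> (expand_level ch q \<sigma>2 (p # W)) (expand_level ch q' \<sigma>2 (p # W))
     (\<alpha> / (2 * \<sigma>2) * (\<Sum>v\<leftarrow>ch (fst p). (real_of_int (q v - q' v))\<^sup>2) +
      \<alpha> / (2 * \<sigma>2) * (\<Sum>v\<leftarrow>concat (map (ch \<circ> fst) W). (real_of_int (q v - q' v))\<^sup>2))"
    unfolding expand_level.simps using assms
    by (intro renyi_bounded_bind_spmf renyi_bounded_expand_node renyi_bounded_map_spmf Cons.IH)
       (auto intro!: mult_nonneg_nonneg divide_nonneg_pos sum_list_nonneg)
  thus ?case by (simp add: ring_distribs o_def)
qed

section \<open>Nodes that survive a level\<close>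

lemma subseq_expand_node:
  assumes "Some xs \<in> set_pmf (expand_node ch q \<sigma>2 p)"
  shows "subseq (map fst xs) (ch (fst p))"
proof -
  obtain qbar where xs: "xs = filter (\<lambda>(v, a). a > 0) (zip (ch (fst p)) qbar)"
    using assms by (cases p) (auto simp: expand_node_def eq_commute[of "Some _"])
  have "subseq (map fst xs) (map fst (zip (ch (fst p)) qbar))"
    unfolding xs by (intro subseq_map subseq_filter_left)
  \<comment> \<open>\<open>zip\<close> stops at the shorter list, so this covers a
    \<open>qbar\<close> of any length.\<close>
  also have "map fst (zip (ch (fst p)) qbar) = take (length qbar) (ch (fst p))"
    by (simp add: map_fst_zip_take min_def)
  also have "subseq \<dots> (ch (fst p))" by (intro prefix_imp_subseq take_is_prefix)
  finally show ?thesis .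
qed

text \<open>A subsequence rather than a subset: it passes on distinctness of the nodes as well as
  membership in the next level.\<close>

lemma subseq_expand_level:
  assumes "Some W' \<in> set_pmf (expand_level ch q \<sigma>2 W)"
  shows "subseq (map fst W') (concat (map (ch \<circ> fst) W))"
  using assms
proof (induction W arbitrary: W')
  case (Cons p W)
  then obtain xs ys where "Some xs \<in> set_pmf (expand_node ch q \<sigma>2 p)"
      "Some ys \<in> set_pmf (expand_level ch q \<sigma>2 W)" "W' = xs @ ys"
    by (auto simp: bind_spmf_def split: option.splits)
  thus ?case
    using Cons.IH[of ys] subseq_expand_node[of xs ch q \<sigma>2 p]
    by (auto intro: list_emb_append_mono)
qed simp

lemma tree_level_subset_nodes: "tree_level u0 ch l \<subseteq> tree_nodes u0 ch"
  by (auto simp: tree_nodes_def)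

lemma finite_tree_level: "finite (tree_level u0 ch l)"
  by (induction l) auto

text \<open>Ensures that no node is charged twice when a cost along lists of children is compared
  with a sum over a level.\<close>

lemma distinct_concat_children:
  assumes "rooted_tree u0 ch T" "distinct us" "set us \<subseteq> tree_nodes u0 ch"
  shows "distinct (concat (map ch us))"
  using assms(2,3)
proof (induction us)
  case (Cons u us)
  thus ?case using assms(1) unfolding rooted_tree_def by fastforce
qed simp

text \<open>Each of the \<open>k\<close> remaining levels costs at most the same amount, whichever
  nodes survived. Distinctness of the nodes in \<open>W\<close> and their common level
  \<open>l\<close> are the invariants of the induction.\<close>

lemma renyi_bounded_expand_levels:
  assumes "\<sigma>2 > 0" "\<alpha> > 1" and tree: "rooted_tree u0 ch T"
    and level: "\<And>l. l \<in> {1..T} \<Longrightarrow>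
        (\<Sum>v\<in>tree_level u0 ch l. (real_of_int (q v - q' v))\<^sup>2) \<le> B"
    and "distinct (map fst W)" "fst ` set W \<subseteq> tree_level u0 ch l" "l + k = T" "B \<ge> 0"
  shows "renyi_bounded \<alpha> (expand_levels ch q \<sigma>2 k W) (expand_levels ch q' \<sigma>2 k W)
           (real k * (\<alpha> / (2 * \<sigma>2) * B))"
  using assms(5-7)
proof (induction k arbitrary: W l)
  case 0
  show ?case using renyi_bounded_refl[OF assms(2) order.refl] by simp
next
  case (Suc k)
  let ?vs = "concat (map (ch \<circ> fst) W)"
  have vs: "distinct ?vs"
    using distinct_concat_children[OF tree Suc.prems(1)] Suc.prems(2) tree_level_subset_nodes[of u0 ch l]
    by auto
  have sub: "set ?vs \<subseteq> tree_level u0 ch (Suc l)"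
    using Suc.prems(2) by auto
  have "(\<Sum>v\<leftarrow>?vs. (real_of_int (q v - q' v))\<^sup>2) = (\<Sum>v\<in>set ?vs. (real_of_int (q v - q' v))\<^sup>2)"
    by (rule sum_list_distinct_conv_sum_set[OF vs])
  \<comment> \<open>Enlarging to the full level makes the bound independent of the earlier
    outcomes.\<close>
  also have "\<dots> \<le> (\<Sum>v\<in>tree_level u0 ch (Suc l). (real_of_int (q v - q' v))\<^sup>2)"
    by (rule sum_mono2[OF finite_tree_level sub]) simp
  also have "\<dots> \<le> B" using Suc.prems(3) by (intro level) auto
  finally have "\<alpha> / (2 * \<sigma>2) * (\<Sum>v\<leftarrow>?vs. (real_of_int (q v - q' v))\<^sup>2) \<le> \<alpha> / (2 * \<sigma>2) * B"
    using assms by (intro mult_left_mono) auto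
  hence one: "renyi_bounded \<alpha> (expand_level ch q \<sigma>2 W) (expand_level ch q' \<sigma>2 W) (\<alpha> / (2 * \<sigma>2) * B)"
    using renyi_bounded_mono[OF assms(2) renyi_bounded_expand_level[OF assms(1,2)]] by blast
  have IH: "renyi_bounded \<alpha> (expand_levels ch q \<sigma>2 k W') (expand_levels ch q' \<sigma>2 k W')
           (real k * (\<alpha> / (2 * \<sigma>2) * B))"
    if W': "Some W' \<in> set_pmf (expand_level ch q \<sigma>2 W)" for W'
  proof (rule Suc.IH)
    obtain N where N: "map fst W' = nths ?vs N"
      using subseq_expand_level[OF W'] by (auto simp: subseq_conv_nths)
    show "distinct (map fst W')"
      unfolding N using vs by (rule distinct_nthsI)
    have "set (map fst W') \<subseteq> set ?vs" unfolding N by (rule set_nths_subset)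
    thus "fst ` set W' \<subseteq> tree_level u0 ch (Suc l)" using sub by simp
    show "Suc l + k = T" using Suc.prems(3) by simp
  qed
  have "renyi_bounded \<alpha> (expand_levels ch q \<sigma>2 (Suc k) W) (expand_levels ch q' \<sigma>2 (Suc k) W)
      (\<alpha> / (2 * \<sigma>2) * B + real k * (\<alpha> / (2 * \<sigma>2) * B))"
    unfolding expand_levels.simps using assms(1,2,8)
    by (intro renyi_bounded_bind_spmf renyi_bounded_map_spmf one IH) auto
  thus ?case by (simp add: algebra_simps add_divide_distrib)
qed

theorem theoremB1:
  fixes \<rho> GS\<^sub>2 :: real and m T :: nat
    and DD :: "('u, 'r) dataset set"
    and u\<^sub>0 :: 'v and ch :: "'v \<Rightarrow> 'v list"
    and q :: "('u, 'r) dataset \<Rightarrow> 'v \<Rightarrow> int"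
  assumes "\<rho> > 0" and "m \<ge> 1" and "T \<ge> 1"
    and tree: "\<And>D. D \<in> DD \<Longrightarrow> nonneg_hierarchical_tree u\<^sub>0 ch T (q D)"
    and root: "\<And>D D'. unbounded_neighbors DD D D' \<Longrightarrow> \<bar>q D u\<^sub>0 - q D' u\<^sub>0\<bar> \<le> int m"
    and level: "\<And>D D' l. unbounded_neighbors DD D D' \<Longrightarrow> l \<in> {1..T} \<Longrightarrow>
        L2_set (\<lambda>u. real_of_int (q D u - q D' u)) (tree_level u\<^sub>0 ch l) \<le> GS\<^sub>2"
  shows "zCDP (unbounded_neighbors DD) (((real m)\<^sup>2 / real T + GS\<^sub>2\<^sup>2) * (\<rho> / 2))
           (\<lambda>D. inf_tda_unbounded u\<^sub>0 ch T (q D) \<rho>)"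
  unfolding zCDP_def
proof (intro allI impI)
  fix D D' :: "('u, 'r) dataset" and \<alpha> :: real
  assume nb: "unbounded_neighbors DD D D'" and \<alpha>: "\<alpha> > 1"
  define \<sigma>2 where "\<sigma>2 = real T / \<rho>"
  have \<sigma>2: "\<sigma>2 > 0" using assms by (simp add: \<sigma>2_def)
  have rooted: "rooted_tree u\<^sub>0 ch T"
    using tree[of D] nb by (simp add: unbounded_neighbors_def nonneg_hierarchical_tree_def)
  have sum_le: "(\<Sum>v\<in>tree_level u\<^sub>0 ch l. (real_of_int (q D v - q D' v))\<^sup>2) \<le> GS\<^sub>2\<^sup>2" if "l \<in> {1..T}" for l
  proof -
    have "(\<Sum>v\<in>tree_level u\<^sub>0 ch l. (real_of_int (q D v - q D' v))\<^sup>2) =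
        (L2_set (\<lambda>u. real_of_int (q D u - q D' u)) (tree_level u\<^sub>0 ch l))\<^sup>2"
      by (simp add: L2_set_def sum_nonneg)
    also have "\<dots> \<le> GS\<^sub>2\<^sup>2"
      by (intro power_mono level nb that L2_set_nonneg)
    finally show ?thesis .
  qed
  \<comment> \<open>The root noise is absorbed into the noisy count \<open>c\<close>; the remainder
    is a kernel in \<open>c\<close>, started from the same input for both datasets.\<close>
  have mech: "inf_tda_unbounded u\<^sub>0 ch T r \<rho> =
      bind_pmf (map_pmf ((+) (r u\<^sub>0)) (discrete_gaussian \<sigma>2)) (\<lambda>c. expand_levels ch r \<sigma>2 T [(u\<^sub>0, c)])" for r
    by (simp add: inf_tda_unbounded_def \<sigma>2_def bind_map_pmf)
  have "(real_of_int (q D u\<^sub>0 - q D' u\<^sub>0))\<^sup>2 \<le> (real m)\<^sup>2"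
    using root[OF nb] by (intro power2_le_iff_abs_le[THEN iffD2]) linarith+
  hence "\<alpha> / (2 * \<sigma>2) * (real_of_int (q D u\<^sub>0 - q D' u\<^sub>0))\<^sup>2 \<le> \<alpha> / (2 * \<sigma>2) * (real m)\<^sup>2"
    using \<alpha> \<sigma>2 by (intro mult_left_mono) auto
  hence "renyi_bounded \<alpha> (map_pmf ((+) (q D u\<^sub>0)) (discrete_gaussian \<sigma>2))
      (map_pmf ((+) (q D' u\<^sub>0)) (discrete_gaussian \<sigma>2)) (\<alpha> / (2 * \<sigma>2) * (real m)\<^sup>2)"
    using renyi_bounded_mono[OF \<alpha> renyi_bounded_discrete_gaussian[OF \<sigma>2 \<alpha>]] by blast
  hence "renyi_bounded \<alpha> (inf_tda_unbounded u\<^sub>0 ch T (q D) \<rho>) (inf_tda_unbounded u\<^sub>0 ch T (q D') \<rho>)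
      (\<alpha> / (2 * \<sigma>2) * (real m)\<^sup>2 + real T * (\<alpha> / (2 * \<sigma>2) * GS\<^sub>2\<^sup>2))"
    unfolding mech
    by (rule renyi_bounded_bind[OF \<alpha>], intro renyi_bounded_expand_levels[OF \<sigma>2 \<alpha> rooted sum_le, where l = 0]) auto
  \<comment> \<open>As \<open>\<alpha> / (2 * \<sigma>2) = \<alpha> * \<rho> / (2 * T)\<close>, the
    \<open>T\<close> levels cancel the divisor \<open>T\<close>, while the root, paid once, keeps
    it.\<close>
  also have "\<alpha> / (2 * \<sigma>2) * (real m)\<^sup>2 + real T * (\<alpha> / (2 * \<sigma>2) * GS\<^sub>2\<^sup>2) =
      \<alpha> * (((real m)\<^sup>2 / real T + GS\<^sub>2\<^sup>2) * (\<rho> / 2))"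
    using assms by (simp add: \<sigma>2_def field_simps)
  finally show "renyi_divergence \<alpha> (inf_tda_unbounded u\<^sub>0 ch T (q D) \<rho>) (inf_tda_unbounded u\<^sub>0 ch T (q D') \<rho>)
      \<le> ereal (\<alpha> * (((real m)\<^sup>2 / real T + GS\<^sub>2\<^sup>2) * (\<rho> / 2)))"
    using \<alpha> \<open>\<rho> > 0\<close> by (intro renyi_divergence_le) auto
qed

end
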